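(* Let $f:F_1\to F_2$ be a tract homomorphism, and let $\varphi$ be a strong Wick function on $E=[n]\cup[n]^*$ with coefficients in $F_1$. Then the composition $f\circ\varphi$ is a strong Wick function on $E$ with coefficients in $F_2$. The same result holds for weak Wick functions (if $\varphi$ is weak, then so is $f\circ\varphi$) and for moderately weak Wick functions (if $\varphi$ is moderately weak, then so is $f\circ\varphi$).
   Context: A tract $F=(G,N_F)$ is an abelian group $G$ (written multiplicatively) with a subset $N_F$ of the group semiring $\mathbb{N}[G]$ such that: $0\in N_F$; $1\notin N_F$; there is a unique $\epsilon\in G$ with $1+\epsilon\in N_F$; and $g\in G$, $a\in N_F$ imply $ga\in N_F$. Write $F$ also for $G\cup\{0\}$ (with $0\cdot x=0$), $F^\times=G$, $-1:=\epsilon$; formal sums of elements of $F$ are regarded as elements of $\mathbb{N}[G]$. A tract homomorphism $F_1\to F_2$ is a group homomorphism $F_1^\times\to F_2^\times$ (extended by $0\mapsto0$) whose induced map $\mathbb{N}[F_1^\times]\to\mathbb{N}[F_2^\times]$ sends $N_{F_1}$ into $N_{F_2}$. $E=[n]\cup[n]^*=\{1,\dots,n\}\cup\{1^*,\dots,n^*\}$ with the involution $*$ exchanging $i$ and $i^*$. A transversal is an $n$-element subset $T\subseteq E$ with $T\cap T^*=\emptyset$; $\mathcal{T}_n$ is the set of transversals; $\triangle$ is symmetric difference. An orthogonal matroid on $E$ is a pair $(E,\mathcal{B})$ with $\mathcal{B}$ a nonempty set of transversals (bases) such that for $B_1,B_2\in\mathcal{B}$ and every $\{x_1,x_1^*\}\subseteq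 B_1\triangle B_2$ there is $\{x_2,x_2^*\}\subseteq B_1\triangle B_2$ with $\{x_2,x_2^*\}\neq\{x_1,x_1^*\}$ and $B_1\triangle\{x_1,x_1^*,x_2,x_2^*\}\in\mathcal{B}$. Let $\varphi:\mathcal{T}_n\to F$. For $T_1,T_2\in\mathcal{T}_n$ with $(T_1\triangle T_2)\cap[n]=\{x_1<\dots<x_m\}$, consider the relation $(\ast)\ \sum_{k=1}^m(-1)^k\varphi(T_1\triangle\{x_k,x_k^*\})\varphi(T_2\triangle\{x_k,x_k^*\})\in N_F$. - $\varphi$ is a strong Wick function if it is not identically zero and $(\ast)$ holds for all $T_1,T_2$. - $\varphi$ is a moderately weak Wick function if its support $\{T:\varphi(T)\neq0\}$ is the set of bases of an orthogonal matroid and $(\ast)$ holds for all $T_1,T_2$ for which at most four of the products $\varphi(T_1\triangle\{x_k,x_k^*\})\varphi(T_2\triangle\{x_k,x_k^*\})$ are nonzero. - $\varphi$ is a weak Wick function if its support is the set of bases of an orthogonal matroid and $(\ast)$ holds for all $T_1,T_2$ with $m=4$. *)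

theory Defs
  imports "HOL-Algebra.Group" "HOL-Library.Multiset"
begin

text \<open>
  An element of the group semiring \<open>\<nat>[G]\<close> is a finitely supported function from \<open>G\<close> to the
  natural numbers, i.e. a multiset over the carrier. Addition is multiset union, \<open>0\<close> is
  \<open>{#}\<close>, and \<open>g\<close> acts by mapping \<open>x \<mapsto> g \<otimes> x\<close> over the multiset.
\<close>

record 'a tract = "'a monoid" +
  nullset :: "'a multiset set"  (\<open>\<N>\<index>\<close>)

locale tract = comm_group F for F (structure) +
  assumes null_closed: "a \<in> \<N> \<Longrightarrow> set_mset a \<subseteq> carrier F"
    and zero_null: "{#} \<in> \<N>"
    and one_not_null: "{#\<one>#} \<notin> \<N>"
    and ex1_neg_one: "\<exists>!e. e \<in> carrier F \<and> {#\<one>, e#} \<in> \<N>"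
    and mult_null: "\<lbrakk>g \<in> carrier F; a \<in> \<N>\<rbrakk> \<Longrightarrow> image_mset (\<lambda>x. g \<otimes> x) a \<in> \<N>"

definition neg_one :: "('a, 'm) tract_scheme \<Rightarrow> 'a" where
  "neg_one F = (THE e. e \<in> carrier F \<and> {#\<one>\<^bsub>F\<^esub>, e#} \<in> nullset F)"

text \<open>
  The set \<open>G \<union> {0}\<close> underlying a tract is represented in the option type: \<open>None\<close> is the
  zero element and \<open>Some g\<close> is the unit \<open>g\<close>. Accordingly, homomorphisms are extended by
  \<open>0 \<mapsto> 0\<close> with \<open>map_option\<close>, and zero summands of a formal sum are dropped in \<open>\<nat>[G]\<close>.
\<close>

definition carrier0 :: "('a, 'm) tract_scheme \<Rightarrow> 'a option set" where
  "carrier0 F = insert None (Some ` carrier F)"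

fun mult0 :: "('a, 'm) tract_scheme \<Rightarrow> 'a option \<Rightarrow> 'a option \<Rightarrow> 'a option" where
  "mult0 F (Some a) (Some b) = Some (a \<otimes>\<^bsub>F\<^esub> b)"
| "mult0 F _ _ = None"

fun formal :: "'a option \<Rightarrow> 'a multiset" where
  "formal None = {#}"
| "formal (Some g) = {#g#}"

definition tract_hom ::
    "('a, 'm) tract_scheme \<Rightarrow> ('b, 'k) tract_scheme \<Rightarrow> ('a \<Rightarrow> 'b) set" where
  "tract_hom F\<^sub>1 F\<^sub>2 = {f \<in> hom F\<^sub>1 F\<^sub>2. \<forall>a \<in> nullset F\<^sub>1. image_mset f a \<in> nullset F\<^sub>2}"

abbreviation hom0 :: "('a \<Rightarrow> 'b) \<Rightarrow> 'a option \<Rightarrow> 'b option" where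
  "hom0 \<equiv> map_option"

text \<open>
  The element \<open>i\<close> of \<open>[n]\<close> is the integer \<open>i\<close>, and \<open>i\<^sup>*\<close> is the integer \<open>-i\<close>.
\<close>

definition star :: "int \<Rightarrow> int" where
  "star x = - x"

definition ground :: "nat \<Rightarrow> int set" where
  "ground n = {1..int n} \<union> star ` {1..int n}"

definition transversals :: "nat \<Rightarrow> int set set" where
  "transversals n = {T. T \<subseteq> ground n \<and> card T = n \<and> T \<inter> star ` T = {}}"

definition orthogonal_matroid :: "nat \<Rightarrow> int set set \<Rightarrow> bool" where
  "orthogonal_matroid n \<B> \<longleftrightarrow>
     \<B> \<noteq> {} \<and> \<B> \<subseteq> transversals n \<and>
     (\<forall>B\<^sub>1 \<in> \<B>. \<forall>B\<^sub>2 \<in> \<B>. \<forall>x\<^sub>1. {x\<^sub>1, star x\<^sub>1} \<subseteq> sym_diff B\<^sub>1 B\<^sub>2 \<longrightarrow>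
        (\<exists>x\<^sub>2. {x\<^sub>2, star x\<^sub>2} \<subseteq> sym_diff B\<^sub>1 B\<^sub>2 \<and> {x\<^sub>2, star x\<^sub>2} \<noteq> {x\<^sub>1, star x\<^sub>1} \<and>
              sym_diff B\<^sub>1 {x\<^sub>1, star x\<^sub>1, x\<^sub>2, star x\<^sub>2} \<in> \<B>))"

text \<open>
  A function on \<open>transversals n\<close> is represented by a function on all sets of integers;
  its values elsewhere are irrelevant to all notions below.
\<close>

text \<open>The increasing list of the elements \<open>x\<^sub>1 < \<dots> < x\<^sub>m\<close>; \<open>x\<^sub>k\<close> is its entry at index \<open>k - 1\<close>.\<close>

definition diff_list :: "nat \<Rightarrow> int set \<Rightarrow> int set \<Rightarrow> int list" where
  "diff_list n T\<^sub>1 T\<^sub>2 = sorted_list_of_set (sym_diff T\<^sub>1 T\<^sub>2 \<inter> {1..int n})"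

definition wick_product ::
    "('a, 'm) tract_scheme \<Rightarrow> nat \<Rightarrow> (int set \<Rightarrow> 'a option) \<Rightarrow> int set \<Rightarrow> int set \<Rightarrow> nat \<Rightarrow> 'a option"
  where
  "wick_product F n \<phi> T\<^sub>1 T\<^sub>2 k =
     (let x = diff_list n T\<^sub>1 T\<^sub>2 ! (k - 1)
      in mult0 F (\<phi> (sym_diff T\<^sub>1 {x, star x})) (\<phi> (sym_diff T\<^sub>2 {x, star x})))"

definition wick_relation ::
    "('a, 'm) tract_scheme \<Rightarrow> nat \<Rightarrow> (int set \<Rightarrow> 'a option) \<Rightarrow> int set \<Rightarrow> int set \<Rightarrow> bool" where
  "wick_relation F n \<phi> T\<^sub>1 T\<^sub>2 \<longleftrightarrow>
     (\<Sum>k = 1..length (diff_list n T\<^sub>1 T\<^sub>2).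
        formal (mult0 F (Some (neg_one F [^]\<^bsub>F\<^esub> k)) (wick_product F n \<phi> T\<^sub>1 T\<^sub>2 k)))
     \<in> nullset F"

definition support :: "nat \<Rightarrow> (int set \<Rightarrow> 'a option) \<Rightarrow> int set set" where
  "support n \<phi> = {T \<in> transversals n. \<phi> T \<noteq> None}"

definition strong_wick :: "('a, 'm) tract_scheme \<Rightarrow> nat \<Rightarrow> (int set \<Rightarrow> 'a option) \<Rightarrow> bool" where
  "strong_wick F n \<phi> \<longleftrightarrow>
     \<phi> \<in> transversals n \<rightarrow> carrier0 F \<and>
     (\<exists>T \<in> transversals n. \<phi> T \<noteq> None) \<and>
     (\<forall>T\<^sub>1 \<in> transversals n. \<forall>T\<^sub>2 \<in> transversals n. wick_relation F n \<phi> T\<^sub>1 T\<^sub>2)"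

definition moderately_weak_wick ::
    "('a, 'm) tract_scheme \<Rightarrow> nat \<Rightarrow> (int set \<Rightarrow> 'a option) \<Rightarrow> bool" where
  "moderately_weak_wick F n \<phi> \<longleftrightarrow>
     \<phi> \<in> transversals n \<rightarrow> carrier0 F \<and>
     orthogonal_matroid n (support n \<phi>) \<and>
     (\<forall>T\<^sub>1 \<in> transversals n. \<forall>T\<^sub>2 \<in> transversals n.
        card {k \<in> {1..length (diff_list n T\<^sub>1 T\<^sub>2)}. wick_product F n \<phi> T\<^sub>1 T\<^sub>2 k \<noteq> None} \<le> 4 \<longrightarrow>
        wick_relation F n \<phi> T\<^sub>1 T\<^sub>2)"

definition weak_wick :: "('a, 'm) tract_scheme \<Rightarrow> nat \<Rightarrow> (int set \<Rightarrow> 'a option) \<Rightarrow> bool" where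
  "weak_wick F n \<phi> \<longleftrightarrow>
     \<phi> \<in> transversals n \<rightarrow> carrier0 F \<and>
     orthogonal_matroid n (support n \<phi>) \<and>
     (\<forall>T\<^sub>1 \<in> transversals n. \<forall>T\<^sub>2 \<in> transversals n.
        length (diff_list n T\<^sub>1 T\<^sub>2) = 4 \<longrightarrow> wick_relation F n \<phi> T\<^sub>1 T\<^sub>2)"

end

theory Submission
  imports Defs
begin

text \<open>
  A tract homomorphism fixes \<open>1\<close> and respects \<open>\<epsilon>\<close> by uniqueness of the latter, so it carries each
  formal sum in a Wick relation of \<open>\<phi>\<close> termwise to the corresponding sum for \<open>f \<circ> \<phi>\<close>. Since units go
  to units, the support and the set of nonvanishing products do not change. Multiplicativity of
  \<open>f\<close> is only available on the carrier, which is why one needs that exchanging \<open>x\<close> and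
  \<open>x\<^sup>*\<close> turns a transversal into a transversal.
\<close>

text \<open>Elements of equal absolute value agree or are exchanged by \<open>star\<close>. Within a
  transversal the second case is excluded, so \<open>abs\<close> is injective on \<open>T\<close>
  and counting finishes.\<close>

lemma abs_image_transversal:
  assumes "T \<in> transversals n"
  shows "abs ` T = {1..int n}"
proof -
  have T: "T \<subseteq> ground n" "card T = n" "T \<inter> star ` T = {}"
    using assms by (auto simp: transversals_def)
  have "inj_on abs T"
    using T(3) by (auto simp: inj_on_def star_def abs_eq_iff)
  then have "card (abs ` T) = n"
    using T(2) by (simp add: card_image)
  moreover have "abs ` T \<subseteq> {1..int n}"
    using T(1) by (auto simp: ground_def star_def)
  ultimately show ?thesis
    by (simp add: card_subset_eq)
qed

lemma finite_transversal: "T \<in> transversals n \<Longrightarrow> finite T"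
  by (auto simp: transversals_def ground_def intro: finite_subset)

lemma replace_star_transversal:
  assumes T: "T \<in> transversals n" and y: "y \<in> T"
  shows "insert (star y) (T - {y}) \<in> transversals n"
proof -
  have sub: "T \<subseteq> ground n" and card: "card T = n" and disj: "T \<inter> star ` T = {}"
    using T by (auto simp: transversals_def)
  have "star y \<notin> T"
    using disj y by auto
  \<comment> \<open>Deleting \<open>y\<close> leaves \<open>card T - 1\<close> elements; inserting
    \<open>star y\<close> undoes this truncated subtraction only if \<open>T\<close> is
    nonempty.\<close>
  moreover have "card T > 0"
    using finite_transversal[OF T] y by (auto simp: card_gt_0_iff)
  ultimately have "card (insert (star y) (T - {y})) = n"
    using finite_transversal[OF T] y card by simp
  moreover have "insert (star y) (T - {y}) \<subseteq> ground n"
    using sub y by (auto simp: ground_def star_def)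
  moreover have "insert (star y) (T - {y}) \<inter> star ` insert (star y) (T - {y}) = {}"
    using disj \<open>star y \<notin> T\<close> y by (fastforce simp: star_def)
  ultimately show ?thesis
    by (simp add: transversals_def)
qed

lemma sym_diff_star_transversal:
  assumes T: "T \<in> transversals n" and x: "x \<in> {1..int n}"
  shows "sym_diff T {x, star x} \<in> transversals n"
proof -
  \<comment> \<open>\<open>y\<close> is whichever of \<open>x\<close> and \<open>star x\<close> lies
    in \<open>T\<close>; the flip merely exchanges it for \<open>star y\<close>.\<close>
  obtain y where y: "y \<in> T" "\<bar>y\<bar> = x"
    using x unfolding abs_image_transversal[OF T, symmetric] by (elim imageE) simp
  have "star y \<notin> T"
    using T y by (auto simp: transversals_def)
  moreover have "{x, star x} = {y, star y}"
    using y(2) by (auto simp: star_def)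
  ultimately have "sym_diff T {x, star x} = insert (star y) (T - {y})"
    using y(1) by auto
  then show ?thesis
    using replace_star_transversal[OF T y(1)] by simp
qed

text \<open>As \<open>k\<close> starts at 1, the truncated \<open>k - 1\<close> is a valid index.
  The bound makes \<open>sym_diff_star_transversal\<close> applicable to the flips in a Wick
  relation.\<close>

lemma diff_list_nth:
  assumes "k \<in> {1..length (diff_list n T\<^sub>1 T\<^sub>2)}"
  shows "diff_list n T\<^sub>1 T\<^sub>2 ! (k - 1) \<in> {1..int n}"
proof -
  have "diff_list n T\<^sub>1 T\<^sub>2 ! (k - 1) \<in> set (diff_list n T\<^sub>1 T\<^sub>2)"
    using assms by (intro nth_mem) auto
  also have "set (diff_list n T\<^sub>1 T\<^sub>2) \<subseteq> {1..int n}"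
    by (simp add: diff_list_def)
  finally show ?thesis .
qed

lemma image_mset_formal: "image_mset f (formal a) = formal (hom0 f a)"
  by (cases a) simp_all

lemma image_mset_sum_fun: "image_mset f (\<Sum>k\<in>A. g k) = (\<Sum>k\<in>A. image_mset f (g k))"
  \<comment> \<open>Over an infinite index set both sums take the default value
    \<open>{#}\<close>.\<close>
  by (induction A rule: infinite_finite_induct) simp_all

lemma mult0_closed:
  assumes "monoid F" "a \<in> carrier0 F" "b \<in> carrier0 F"
  shows "mult0 F a b \<in> carrier0 F"
  using assms by (auto simp: carrier0_def intro: monoid.m_closed)

lemma hom0_mult0:
  assumes "f \<in> hom F\<^sub>1 F\<^sub>2" "a \<in> carrier0 F\<^sub>1" "b \<in> carrier0 F\<^sub>1"
  shows "hom0 f (mult0 F\<^sub>1 a b) = mult0 F\<^sub>2 (hom0 f a) (hom0 f b)"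
  using assms by (auto simp: carrier0_def hom_mult)

lemma hom0_closed:
  assumes "f \<in> hom F\<^sub>1 F\<^sub>2" "a \<in> carrier0 F\<^sub>1"
  shows "hom0 f a \<in> carrier0 F\<^sub>2"
  using assms by (auto simp: carrier0_def hom_in_carrier)

lemma (in tract) neg_one:
  "neg_one F \<in> carrier F" "{#\<one>, neg_one F#} \<in> \<N>"
  using theI'[OF ex1_neg_one] by (simp_all add: neg_one_def)

lemma (in tract) neg_one_eqI:
  "\<lbrakk>e \<in> carrier F; {#\<one>, e#} \<in> \<N>\<rbrakk> \<Longrightarrow> neg_one F = e"
  using ex1_neg_one neg_one by blast

text \<open>\<open>map_option\<close> sends only \<open>None\<close> to \<open>None\<close>, so the
  matroid condition carries over verbatim.\<close>

lemma support_hom0_comp: "support n (hom0 f \<circ> \<phi>) = support n \<phi>"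
  by (simp add: support_def)

locale tract_morphism = F1: tract F\<^sub>1 + F2: tract F\<^sub>2
  for F\<^sub>1 :: "('a, 'm) tract_scheme" and F\<^sub>2 :: "('b, 'k) tract_scheme" +
  fixes f :: "'a \<Rightarrow> 'b"
  assumes tract_hom: "f \<in> tract_hom F\<^sub>1 F\<^sub>2"
begin

lemma f_hom: "f \<in> hom F\<^sub>1 F\<^sub>2"
  using tract_hom by (simp add: tract_hom_def)

lemma image_null: "a \<in> nullset F\<^sub>1 \<Longrightarrow> image_mset f a \<in> nullset F\<^sub>2"
  using tract_hom by (simp add: tract_hom_def)

sublocale group_hom F\<^sub>1 F\<^sub>2 f
  by unfold_locales (rule f_hom)

lemma hom_neg_one: "f (neg_one F\<^sub>1) = neg_one F\<^sub>2"
  \<comment> \<open>Applying \<open>f\<close> to the null sum 1 + \<epsilon> gives the null sum 1 +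
    \<open>f\<close> \<epsilon>, which determines \<open>f\<close> \<epsilon> in the target.\<close>
  using F2.neg_one_eqI[of "f (neg_one F\<^sub>1)"] image_null[OF F1.neg_one(2)] F1.neg_one(1)
  by simp

context
  fixes n :: nat and \<phi> :: "int set \<Rightarrow> 'a option" and T\<^sub>1 T\<^sub>2 :: "int set"
  assumes \<phi>: "\<phi> \<in> transversals n \<rightarrow> carrier0 F\<^sub>1"
    and T: "T\<^sub>1 \<in> transversals n" "T\<^sub>2 \<in> transversals n"
begin

text \<open>Letting \<open>S\<close> be either transversal covers both factors of a Wick product at
  once.\<close>

lemma flip_closed:
  assumes "k \<in> {1..length (diff_list n T\<^sub>1 T\<^sub>2)}" "S \<in> {T\<^sub>1, T\<^sub>2}"
  defines "x \<equiv> diff_list n T\<^sub>1 T\<^sub>2 ! (k - 1)"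
  shows "\<phi> (sym_diff S {x, star x}) \<in> carrier0 F\<^sub>1"
proof -
  have "sym_diff S {x, star x} \<in> transversals n"
    unfolding x_def using T assms(2) sym_diff_star_transversal diff_list_nth[OF assms(1)] by auto
  then show ?thesis
    by (rule funcset_mem[OF \<phi>])
qed

lemma wick_product_closed:
  assumes "k \<in> {1..length (diff_list n T\<^sub>1 T\<^sub>2)}"
  shows "wick_product F\<^sub>1 n \<phi> T\<^sub>1 T\<^sub>2 k \<in> carrier0 F\<^sub>1"
  using flip_closed[OF assms] by (simp add: wick_product_def Let_def mult0_closed F1.is_monoid)

lemma wick_product_hom0:
  assumes "k \<in> {1..length (diff_list n T\<^sub>1 T\<^sub>2)}"
  shows "wick_product F\<^sub>2 n (hom0 f \<circ> \<phi>) T\<^sub>1 T\<^sub>2 k = hom0 f (wick_product F\<^sub>1 n \<phi> T\<^sub>1 T\<^sub>2 k)"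
  using flip_closed[OF assms] by (simp add: wick_product_def Let_def hom0_mult0[OF f_hom])

text \<open>This transfers the bound of four in the moderately weak case: the pairs to be checked
  are the same before and after composing with \<open>f\<close>.\<close>

lemma nonzero_wick_products_hom0:
  "{k \<in> {1..length (diff_list n T\<^sub>1 T\<^sub>2)}. wick_product F\<^sub>2 n (hom0 f \<circ> \<phi>) T\<^sub>1 T\<^sub>2 k \<noteq> None} =
   {k \<in> {1..length (diff_list n T\<^sub>1 T\<^sub>2)}. wick_product F\<^sub>1 n \<phi> T\<^sub>1 T\<^sub>2 k \<noteq> None}"
  using wick_product_hom0 by (intro Collect_cong conj_cong) simp_all

lemma wick_relation_hom0:
  assumes "wick_relation F\<^sub>1 n \<phi> T\<^sub>1 T\<^sub>2"
  shows "wick_relation F\<^sub>2 n (hom0 f \<circ> \<phi>) T\<^sub>1 T\<^sub>2"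
proof -
  let ?K = "{1..length (diff_list n T\<^sub>1 T\<^sub>2)}"
  let ?s1 = "\<lambda>k. mult0 F\<^sub>1 (Some (neg_one F\<^sub>1 [^]\<^bsub>F\<^sub>1\<^esub> k)) (wick_product F\<^sub>1 n \<phi> T\<^sub>1 T\<^sub>2 k)"
  let ?s2 = "\<lambda>k. mult0 F\<^sub>2 (Some (neg_one F\<^sub>2 [^]\<^bsub>F\<^sub>2\<^esub> k))
    (wick_product F\<^sub>2 n (hom0 f \<circ> \<phi>) T\<^sub>1 T\<^sub>2 k)"
  have "hom0 f (?s1 k) = ?s2 k" if "k \<in> ?K" for k
  proof -
    \<comment> \<open>The sign must lie in the carrier before \<open>f\<close> can be split over its
      product with the Wick product.\<close>
    have "Some (neg_one F\<^sub>1 [^]\<^bsub>F\<^sub>1\<^esub> k) \<in> carrier0 F\<^sub>1"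
      using F1.neg_one(1) by (simp add: carrier0_def)
    then have "hom0 f (?s1 k) =
        mult0 F\<^sub>2 (Some (f (neg_one F\<^sub>1 [^]\<^bsub>F\<^sub>1\<^esub> k))) (hom0 f (wick_product F\<^sub>1 n \<phi> T\<^sub>1 T\<^sub>2 k))"
      using hom0_mult0[OF f_hom _ wick_product_closed[OF that]] by simp
    then show ?thesis
      using F1.neg_one(1) wick_product_hom0[OF that] by (simp add: hom_nat_pow hom_neg_one)
  qed
  then have "image_mset f (\<Sum>k\<in>?K. formal (?s1 k)) = (\<Sum>k\<in>?K. formal (?s2 k))"
    unfolding image_mset_sum_fun by (intro sum.cong) (simp_all only: image_mset_formal)
  then show ?thesis
    using image_null assms unfolding wick_relation_def by metis
qed

end

lemma hom0_comp_closed: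
  "\<phi> \<in> transversals n \<rightarrow> carrier0 F\<^sub>1 \<Longrightarrow> hom0 f \<circ> \<phi> \<in> transversals n \<rightarrow> carrier0 F\<^sub>2"
  using hom0_closed[OF f_hom] by (auto simp: Pi_iff)

text \<open>A transversal at which \<phi> is nonzero is again a witness after composing with
  \<open>f\<close>.\<close>

lemma strong_wick_hom0: "strong_wick F\<^sub>1 n \<phi> \<Longrightarrow> strong_wick F\<^sub>2 n (hom0 f \<circ> \<phi>)"
  unfolding strong_wick_def
  using hom0_comp_closed wick_relation_hom0 by (metis comp_apply map_option_is_None)

text \<open>The condition of length 4 involves only the two transversals, not the coefficients, so
  it selects the same pairs on both sides.\<close>

lemma weak_wick_hom0: "weak_wick F\<^sub>1 n \<phi> \<Longrightarrow> weak_wick F\<^sub>2 n (hom0 f \<circ> \<phi>)"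
  unfolding weak_wick_def support_hom0_comp
  using hom0_comp_closed wick_relation_hom0 by blast

lemma moderately_weak_wick_hom0:
  "moderately_weak_wick F\<^sub>1 n \<phi> \<Longrightarrow> moderately_weak_wick F\<^sub>2 n (hom0 f \<circ> \<phi>)"
  unfolding moderately_weak_wick_def support_hom0_comp
  using hom0_comp_closed wick_relation_hom0 nonzero_wick_products_hom0 by (metis (lifting))

end

theorem proposition3p22:
  fixes F\<^sub>1 :: "('a, 'm) tract_scheme"
    and F\<^sub>2 :: "('b, 'k) tract_scheme"
    and f :: "'a \<Rightarrow> 'b"
    and n :: nat
    and \<phi> :: "int set \<Rightarrow> 'a option"
  assumes "tract F\<^sub>1" and "tract F\<^sub>2" and "f \<in> tract_hom F\<^sub>1 F\<^sub>2"
  shows "(strong_wick F\<^sub>1 n \<phi> \<longrightarrow> strong_wick F\<^sub>2 n (hom0 f \<circ> \<phi>)) \<and>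
         (weak_wick F\<^sub>1 n \<phi> \<longrightarrow> weak_wick F\<^sub>2 n (hom0 f \<circ> \<phi>)) \<and>
         (moderately_weak_wick F\<^sub>1 n \<phi> \<longrightarrow> moderately_weak_wick F\<^sub>2 n (hom0 f \<circ> \<phi>))"
proof -
  interpret tract_morphism F\<^sub>1 F\<^sub>2 f
    using assms by (intro tract_morphism.intro tract_morphism_axioms.intro)
  show ?thesis
    using strong_wick_hom0 weak_wick_hom0 moderately_weak_wick_hom0 by blast
qed

end
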